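(* Let $n \ge 1$ and $\alpha \in (0,1)$. The juggler's exclusion process on $S_n$ generated by the memoryless height distributions $(\nu_B)_{B \in S_{n-1}}$ with parameter $\alpha$ has a unique equilibrium distribution, and this equilibrium is the distribution of the random set $G_n = U(\xi_1,\dots,\xi_n)$, the noncolliding union of $n$ independent random variables $\xi_1,\dots,\xi_n$ with $\Pr(\xi_i = k) = (1-\alpha)\alpha^k$ for $k \in \mathbb{Z}_+$.
   Context: $\mathbb{Z}_+ = \{0,1,2,\dots\}$; $S_m$ is the set of $m$-element subsets of $\mathbb{Z}_+$; $[0,k]=\{0,1,\dots,k\}$ (empty if $k=-1$). $A-1 = \{a-1: a\in A\}$; $A^* = A\setminus\{\min A\}$ for finite nonempty $A$; $B^c = \mathbb{Z}_+\setminus B$. For finite $B \subset \mathbb{Z}_+$, the memoryless distribution on $B^c$ with parameter $\alpha$ is $\nu_B(y) = (1-\alpha)\alpha^{h_B(y)}$ for $y \in B^c$ and $\nu_B(y) = 0$ for $y \in B$, where $h_B(y) = |[0,y-1]\setminus B|$. The juggler's exclusion process (JEP) with $n$ particles generated by $(\nu_B)_{B\in S_{n-1}}$ is the discrete-time Markov chain on $S_n$ with transition matrix $P(A,B) = 1$ if $0\notin A$ and $B = A-1$; $P(A,B) = \nu_{A^*-1}(y)$ if $0 \in A$ and $B = (A^*-1)\cup\{y\}$ with $y \notin A^*-1$; and $P(A,B)=0$ otherwise. An equilibrium distribution is a probability measure $\pi$ on $S_n$ with $\pi P=\pi$. For finite $A\subset\mathbb{Z}_+$, the $A$-avoiding shift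 is $\theta_A(x) = \min\{m \ge 0 : |[0,m]\setminus A| \ge x+1\}$, $x\in\mathbb{Z}_+$. The noncolliding union of $A$ and (possibly nondistinct) points $x_1,\dots,x_n\in\mathbb{Z}_+$ is defined recursively by $U(A,x_1) = A\cup\{\theta_A(x_1)\}$ and $U(A,x_1,\dots,x_{k+1}) = C\cup\{\theta_{C}(x_{k+1})\}$ with $C = U(A,x_1,\dots,x_k)$; and $U(x_1,\dots,x_n) = U(\emptyset,x_1,\dots,x_n)$. *)

theory Defs
  imports "HOL-Probability.Probability" "HOL-Library.Ramsey"
begin

text \<open>
  The set of \<open>m\<close>-element subsets of \<open>\<int>\<^sub>+\<close> is the library's \<^term>\<open>nsets (UNIV :: nat set) m\<close>.
\<close>

text \<open>
  \<open>A - 1\<close>. Subtraction on \<^typ>\<open>nat\<close> truncates, so this is only used for sets not containing \<open>0\<close>.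
\<close>
definition shift_down :: "nat set \<Rightarrow> nat set" where
  "shift_down A = (\<lambda>a. a - 1) ` A"

definition drop_min :: "nat set \<Rightarrow> nat set" where
  "drop_min A = A - {Min A}"

text \<open>\<open>{..<y}\<close> is the interval \<open>[0, y - 1]\<close>, empty for \<open>y = 0\<close>.\<close>
definition free_below :: "nat set \<Rightarrow> nat \<Rightarrow> nat" where
  "free_below B y = card ({..<y} - B)"

definition memoryless :: "real \<Rightarrow> nat set \<Rightarrow> nat \<Rightarrow> real" where
  "memoryless \<alpha> B y = (if y \<in> B then 0 else (1 - \<alpha>) * \<alpha> ^ free_below B y)"

text \<open>
  Transition matrix of the juggler's exclusion process generated by a family \<open>\<nu>\<close>. The \<open>y\<close> below is
  unique when it exists, being the only element of \<open>B - C\<close>.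
\<close>
definition jep_matrix :: "(nat set \<Rightarrow> nat \<Rightarrow> real) \<Rightarrow> nat set \<Rightarrow> nat set \<Rightarrow> real" where
  "jep_matrix \<nu> A B =
    (if 0 \<notin> A then (if B = shift_down A then 1 else 0)
     else let C = shift_down (drop_min A) in
       if \<exists>y. y \<notin> C \<and> B = C \<union> {y} then \<nu> C (THE y. y \<notin> C \<and> B = C \<union> {y}) else 0)"

definition jep_equilibrium ::
    "nat \<Rightarrow> (nat set \<Rightarrow> nat \<Rightarrow> real) \<Rightarrow> nat set measure \<Rightarrow> bool" where
  "jep_equilibrium n \<nu> \<pi> \<longleftrightarrow>
    prob_space \<pi> \<and> sets \<pi> = sets (count_space (nsets UNIV n)) \<and>
    (\<forall>B \<in> nsets UNIV n.
      ((\<lambda>A. measure \<pi> {A} * jep_matrix \<nu> A B) has_sum measure \<pi> {B}) (nsets UNIV n))"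

definition avoiding_shift :: "nat set \<Rightarrow> nat \<Rightarrow> nat" where
  "avoiding_shift A x = (LEAST m. card ({0..m} - A) \<ge> x + 1)"

text \<open>
  \<open>noncolliding_union A x n\<close> is \<open>U(A, x\<^sub>1, \<dots>, x\<^sub>n)\<close>; the value \<open>x 0\<close> is not used.
\<close>
primrec noncolliding_union :: "nat set \<Rightarrow> (nat \<Rightarrow> nat) \<Rightarrow> nat \<Rightarrow> nat set" where
  "noncolliding_union A x 0 = A"
| "noncolliding_union A x (Suc k) =
    (let C = noncolliding_union A x k in C \<union> {avoiding_shift C (x (Suc k))})"

end

theory Submission
  imports Defs
begin

text \<open>
  The equilibrium has an explicit density: up to a constant, a state \<open>B\<close> has weight \<open>\<alpha> ^ \<Sum>B\<close>, where
  \<open>\<Sum>B\<close> is the sum of the positions of the particles. Everything rests on one identity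
  (\<open>removal_weight\<close>). If \<open>b\<close> is the element of rank \<open>i\<close> in \<open>B\<close>, meaning that \<open>i\<close> elements of \<open>B\<close> lie below it,
  then \<open>b - i\<close> sites below \<open>b\<close> are free in \<open>B - {b}\<close>. Hence the weight of \<open>B - {b}\<close> times the factor
  \<open>\<alpha> ^ (b - i)\<close> of the memoryless distribution at \<open>b\<close> equals \<open>\<alpha> ^ \<Sum>B\<close> times \<open>\<alpha> ^ - i\<close>.

  The noncolliding union adds a point to \<open>G\<^sub>k\<close> with the memoryless distribution on the complement of
  \<open>G\<^sub>k\<close>. By induction on \<open>k\<close>, summing the identity over the point added last shows that the law of \<open>G\<^sub>k\<close> is
  proportional to \<open>\<alpha> ^ \<Sum>B\<close> (\<open>prob_noncolliding_union\<close>). The same identity, summed over the landing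
  site of the last throw and combined with the contribution of a pure shift, shows that this weight
  is stationary: with \<open>n\<close> particles the balance at \<open>B\<close> reads
  \<open>\<alpha> ^ n + (1 - \<alpha>) (1 + \<alpha> + \<dots> + \<alpha> ^ (n - 1)) = 1\<close> (\<open>geometric_weight_stationary\<close>).

  For uniqueness, let \<open>D\<close> be the difference of two equilibria. Its positive part is again stationary,
  because it is dominated by its image under the transition matrix, which does not increase mass
  (\<open>positive_part_stationary\<close>). Every state leads to the ground state \<open>{..<n}\<close> by always throwing to the
  lowest free site (\<open>jep_reaches_ground_state\<close>). So if \<open>D\<close> took both signs, both \<open>D\<close> and \<open>- D\<close> would be
  positive at the ground state. Thus \<open>D\<close> has one sign and total mass \<open>0\<close>, and it vanishes.
\<close>

section \<open>Stationary measures of a substochastic matrix\<close>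

lemma has_sum_sum_finite:
  fixes f :: "'i \<Rightarrow> 'a \<Rightarrow> real"
  assumes "finite F" "\<And>i. i \<in> F \<Longrightarrow> (f i has_sum s i) S"
  shows "((\<lambda>x. \<Sum>i\<in>F. f i x) has_sum (\<Sum>i\<in>F. s i)) S"
  using assms by (induction F rule: finite_induct) (auto intro!: has_sum_add)

text \<open>
  The pointwise inequality \<open>D\<^sup>+ \<le> D\<^sup>+ P\<close> holds because \<open>D = D P\<close> and \<open>P \<ge> 0\<close>. Since \<open>P\<close> is
  substochastic, the total mass of \<open>D\<^sup>+ P\<close> is at most that of \<open>D\<^sup>+\<close>, so the inequality cannot be
  strict anywhere. The mass comparison is made on finite sets of target states only, which avoids
  exchanging two infinite sums.
\<close>
lemma positive_part_stationary:
  fixes P :: "'a \<Rightarrow> 'a \<Rightarrow> real"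
  assumes P0: "\<And>A B. A \<in> S \<Longrightarrow> B \<in> S \<Longrightarrow> 0 \<le> P A B"
    and sub: "\<And>A F. A \<in> S \<Longrightarrow> finite F \<Longrightarrow> F \<subseteq> S \<Longrightarrow> (\<Sum>B\<in>F. P A B) \<le> 1"
    and D: "D summable_on S"
    and stat: "\<And>B. B \<in> S \<Longrightarrow> ((\<lambda>A. D A * P A B) has_sum D B) S"
    and B: "B \<in> S"
  shows "((\<lambda>A. max 0 (D A) * P A B) has_sum max 0 (D B)) S"
proof -
  define g where "g A = max 0 (D A)" for A
  have g0: "0 \<le> g A" for A by (simp add: g_def)
  have "(\<lambda>A. norm (D A)) summable_on S"
    using D by (rule summable_on_iff_abs_summable_on_real[THEN iffD1])
  then have g: "g summable_on S"
    by (rule summable_on_comparison_test) (auto simp: g_def)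
  then obtain T where T: "(g has_sum T) S"
    by (auto simp: summable_on_def)
  have P1: "P A B \<le> 1" if "A \<in> S" "B \<in> S" for A B
    using sub[of A "{B}"] that by simp
  define E where "E B = infsum (\<lambda>A. g A * P A B) S" for B
  have E: "((\<lambda>A. g A * P A B) has_sum E B) S" if "B \<in> S" for B
    unfolding E_def
    by (rule has_sum_infsum, rule summable_on_comparison_test[OF g])
      (use that P0 P1 g0 in \<open>auto intro!: mult_left_le\<close>)
  have gE: "g B \<le> E B" if "B \<in> S" for B
  proof -
    have "D B \<le> E B"
      by (rule has_sum_mono[OF stat[OF that] E[OF that]])
        (use that P0 in \<open>auto simp: g_def intro!: mult_right_mono\<close>)
    moreover have "0 \<le> E B"
      by (rule has_sum_nonneg[OF E[OF that]]) (use that P0 g0 in auto)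
    ultimately show ?thesis by (simp add: g_def)
  qed
  have ET: "(\<Sum>B\<in>F. E B) \<le> T" if F: "finite F" "F \<subseteq> S" for F
  proof (rule has_sum_mono[OF _ T])
    show "((\<lambda>A. \<Sum>B\<in>F. g A * P A B) has_sum (\<Sum>B\<in>F. E B)) S"
      using F by (intro has_sum_sum_finite E) auto
    show "(\<Sum>B\<in>F. g A * P A B) \<le> g A" if "A \<in> S" for A
      using mult_left_mono[OF sub[OF that F] g0[of A]] by (simp add: sum_distrib_left)
  qed
  have "E B \<le> g B"
  proof (rule field_le_epsilon)
    fix e :: real assume "0 < e"
    then obtain F where F: "finite F" "F \<subseteq> S" "dist (sum g F) T \<le> e"
      using has_sum_finite_approximation[OF T] by blast
    \<comment> \<open>\<open>F\<close> carries all but \<open>e\<close> of the mass \<open>T\<close>, and \<open>g \<le> E\<close> on the rest of \<open>F\<close>, so an excess of \<open>E\<close> over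
      \<open>g\<close> at \<open>B\<close> by more than \<open>e\<close> would push the mass of \<open>E\<close> above \<open>T\<close>.\<close>
    let ?F = "insert B F" and ?R = "F - {B}"
    have "T - e \<le> sum g F" using F(3) by (auto simp: dist_real_def)
    also have "\<dots> \<le> sum g ?F" using F g0 by (intro sum_mono2) auto
    also have "\<dots> = g B + sum g ?R" using F by (simp add: sum.insert_remove)
    also have "sum g ?R \<le> sum E ?R" using F gE by (intro sum_mono) auto
    finally have "T - e \<le> g B + sum E ?R" by simp
    moreover have "E B + sum E ?R \<le> T"
      using ET[of ?F] F B by (simp add: sum.insert_remove)
    ultimately show "E B \<le> g B + e" by simp
  qed
  with gE[OF B] have "E B = g B" by simp
  with E[OF B] show ?thesis by (simp add: g_def)
qed

text \<open>
  Stationary positive mass flows along transitions of positive probability, so for a stationary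
  signed \<open>D\<close> every state with \<open>D > 0\<close> forces \<open>D s > 0\<close> (apply this to \<open>D\<^sup>+\<close>), and every state with
  \<open>D < 0\<close> forces \<open>D s < 0\<close>. Hence the difference of two stationary measures has one sign, and it
  vanishes when their masses agree.
\<close>
lemma stationary_unique:
  fixes P :: "'a \<Rightarrow> 'a \<Rightarrow> real"
  assumes P0: "\<And>A B. A \<in> S \<Longrightarrow> B \<in> S \<Longrightarrow> 0 \<le> P A B"
    and sub: "\<And>A F. A \<in> S \<Longrightarrow> finite F \<Longrightarrow> F \<subseteq> S \<Longrightarrow> (\<Sum>B\<in>F. P A B) \<le> 1"
    and reach: "\<And>A. A \<in> S \<Longrightarrow> (A, s) \<in> {(A, B). A \<in> S \<and> B \<in> S \<and> 0 < P A B}\<^sup>*"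
    and mass: "(\<mu> has_sum t) S" "(\<nu> has_sum t) S"
    and stat: "\<And>B. B \<in> S \<Longrightarrow> ((\<lambda>A. \<mu> A * P A B) has_sum \<mu> B) S"
      "\<And>B. B \<in> S \<Longrightarrow> ((\<lambda>A. \<nu> A * P A B) has_sum \<nu> B) S"
    and A: "A \<in> S"
  shows "\<mu> A = \<nu> A"
proof -
  have pos: "0 < D s"
    if D: "(D has_sum 0) S" and st: "\<And>B. B \<in> S \<Longrightarrow> ((\<lambda>A. D A * P A B) has_sum D B) S"
      and A: "A \<in> S" "0 < D A" for D A
    using reach[OF A(1)]
  proof (induction rule: rtrancl_induct)
    case base
    show ?case by fact
  next
    case (step B C)
    then have BC: "B \<in> S" "C \<in> S" "0 < P B C" by auto
    have st': "((\<lambda>A. max 0 (D A) * P A C) has_sum max 0 (D C)) S"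
      using D by (intro positive_part_stationary P0 sub st BC) (auto simp: summable_on_def)
    have "0 < max 0 (D B) * P B C" using step BC by simp
    also have "\<dots> \<le> max 0 (D C)"
      using finite_sum_le_has_sum[OF st', of "{B}"] BC P0 by auto
    finally show ?case by simp
  qed
  have nonpos: "D A \<le> 0"
    if D: "(D has_sum 0) S" and st: "\<And>B. B \<in> S \<Longrightarrow> ((\<lambda>A. D A * P A B) has_sum D B) S" for D
  proof (rule ccontr)
    assume "\<not> D A \<le> 0"
    then have A0: "0 < D A" by simp
    have "0 \<le> D C" if "C \<in> S" for C
    proof (rule ccontr)
      assume "\<not> 0 \<le> D C"
      moreover have "((\<lambda>C. - D C) has_sum 0) S"
        using has_sum_uminusI[OF D] by simp
      moreover have "((\<lambda>A. - D A * P A B) has_sum - D B) S" if "B \<in> S" for B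
        using has_sum_uminusI[OF st[OF that]] by simp
      ultimately have "0 < - D s"
        using pos[of "\<lambda>C. - D C" C] \<open>C \<in> S\<close> by simp
      with pos[OF D st A A0] show False by simp
    qed
    then have "D A = 0"
      using nonneg_has_sum_le_0D[OF D _ _ A] by auto
    with A0 show False by simp
  qed
  have diff: "f A - h A \<le> 0"
    if fh: "(f has_sum t) S" "(h has_sum t) S"
      and st_f: "\<And>B. B \<in> S \<Longrightarrow> ((\<lambda>A. f A * P A B) has_sum f B) S"
      and st_h: "\<And>B. B \<in> S \<Longrightarrow> ((\<lambda>A. h A * P A B) has_sum h B) S" for f h
  proof (rule nonpos[of "\<lambda>A. f A - h A"])
    show "((\<lambda>A. f A - h A) has_sum 0) S"
      using has_sum_add[OF fh(1) has_sum_uminusI[OF fh(2)]] by simp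
    show "((\<lambda>A. (f A - h A) * P A B) has_sum f B - h B) S" if "B \<in> S" for B
      using has_sum_add[OF st_f[OF that] has_sum_uminusI[OF st_h[OF that]]]
      by (simp add: left_diff_distrib)
  qed
  show ?thesis
    using diff[OF mass stat] diff[OF mass(2,1) stat(2,1)] by simp
qed

section \<open>The avoiding shift and the noncolliding union\<close>

lemma free_below_Suc: "free_below C (Suc y) = free_below C y + (if y \<in> C then 0 else 1)"
proof -
  have "{..<Suc y} - C = (if y \<in> C then {..<y} - C else insert y ({..<y} - C))"
    by (auto simp: less_Suc_eq)
  then show ?thesis by (simp add: free_below_def)
qed

lemma free_below_mono: "x \<le> y \<Longrightarrow> free_below C x \<le> free_below C y"
  unfolding free_below_def by (intro card_mono) auto

lemma free_below_inj: "inj_on (free_below C) (- C)"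
proof (rule linorder_inj_onI')
  fix x y assume "x \<in> - C" "x < y"
  then show "free_below C x \<noteq> free_below C y"
    using free_below_mono[of "Suc x" y C] by (simp add: free_below_Suc)
qed

lemma avoiding_shift_eq_LEAST: "avoiding_shift C x = (LEAST m. x < free_below C (Suc m))"
  by (simp add: avoiding_shift_def free_below_def atLeast0AtMost lessThan_Suc_atMost Suc_le_eq)

lemma avoiding_shift_free_below:
  assumes "a \<notin> C" shows "avoiding_shift C (free_below C a) = a"
  unfolding avoiding_shift_eq_LEAST
proof (rule Least_equality)
  show "free_below C a < free_below C (Suc a)" using assms by (simp add: free_below_Suc)
  show "a \<le> m" if "free_below C a < free_below C (Suc m)" for m
    using that free_below_mono[of "Suc m" a C] by (cases "Suc m \<le> a") auto
qed

lemma
  assumes "finite C"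
  shows avoiding_shift_notin: "avoiding_shift C x \<notin> C" (is ?A)
    and free_below_avoiding_shift: "free_below C (avoiding_shift C x) = x" (is ?B)
proof -
  let ?P = "\<lambda>m. x < free_below C (Suc m)" and ?m = "avoiding_shift C x"
  have "Suc x \<le> card ({..<Suc (x + card C)} - C)"
    using diff_card_le_card_Diff[OF assms, of "{..<Suc (x + card C)}"] by simp
  then have ex: "?P (x + card C)" by (simp add: free_below_def)
  have 1: "?P ?m"
    unfolding avoiding_shift_eq_LEAST by (rule LeastI[of ?P, OF ex])
  have 2: "free_below C ?m \<le> x"
  proof (cases ?m)
    case 0
    then show ?thesis by (simp add: free_below_def)
  next
    case (Suc k)
    then have "\<not> ?P k"
      unfolding avoiding_shift_eq_LEAST by (intro not_less_Least) simp
    then show ?thesis using Suc by simp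
  qed
  show ?A ?B using 1 2 by (auto simp: free_below_Suc split: if_splits)
qed

lemma noncolliding_union_nsets: "noncolliding_union {} x k \<in> nsets UNIV k"
proof (induction k)
  case (Suc k)
  then show ?case
    using avoiding_shift_notin[of "noncolliding_union {} x k" "x (Suc k)"]
    by (auto simp: nsets_def Let_def)
qed (auto simp: nsets_def)

lemma noncolliding_union_cong:
  assumes "\<And>i. i \<in> {1..k} \<Longrightarrow> x i = y i"
  shows "noncolliding_union A x k = noncolliding_union A y k"
  using assms by (induction k) (auto simp: Let_def)

text \<open>
  This decomposes the event \<open>G\<^sub>k\<^sub>+\<^sub>1 = B\<close> according to which point \<open>b\<close> of \<open>B\<close> was added last. The added
  point determines the new coordinate, since \<^term>\<open>avoiding_shift C\<close> is the inverse of
  \<^term>\<open>free_below C\<close> on the complement of \<open>C\<close>.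
\<close>
lemma noncolliding_union_Suc_eq_iff:
  assumes B: "B \<in> nsets UNIV (Suc k)"
  shows "noncolliding_union {} x (Suc k) = B \<longleftrightarrow>
    (\<exists>b\<in>B. noncolliding_union {} x k = B - {b} \<and> x (Suc k) = free_below (B - {b}) b)"
    (is "?L \<longleftrightarrow> ?R")
proof -
  let ?C = "noncolliding_union {} x k" and ?b = "avoiding_shift (noncolliding_union {} x k) (x (Suc k))"
  have fin: "finite ?C" using noncolliding_union_nsets[of x k] by (simp add: nsets_def)
  note notin = avoiding_shift_notin[OF fin, of "x (Suc k)"]
  show ?thesis
  proof
    assume L: ?L
    have "B = insert ?b ?C" using L by (simp add: Let_def)
    moreover from this have "B - {?b} = ?C" using notin by auto
    ultimately show ?R
      using free_below_avoiding_shift[OF fin] by (intro bexI[of _ ?b]) auto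
  next
    assume ?R
    then obtain b where b: "b \<in> B" "?C = B - {b}" "x (Suc k) = free_below (B - {b}) b" by blast
    then have "?b = b" by (simp add: avoiding_shift_free_below)
    with b show ?L by (auto simp: Let_def)
  qed
qed

section \<open>The weight of removing and restoring a point\<close>

text \<open>
  The number of elements of \<open>B\<close> below \<open>b\<close> is the rank of \<open>b\<close>, and it runs through \<open>0, \<dots>, card B - 1\<close>.
\<close>
lemma sum_over_ranks:
  fixes g :: "nat \<Rightarrow> 'b :: comm_monoid_add" and B :: "'a :: linorder set"
  assumes "finite B"
  shows "(\<Sum>b\<in>B. g (card (B \<inter> {..<b}))) = (\<Sum>i<card B. g i)"
  using assms
proof (induction rule: finite_linorder_max_induct)
  case (insert b A)
  have "insert b A \<inter> {..<a} = A \<inter> {..<a}" if "a \<in> A" for a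
    using insert(2) that by fastforce
  moreover have "insert b A \<inter> {..<b} = A" using insert(2) by auto
  ultimately show ?case using insert by (auto simp: add.commute)
qed simp

lemma free_below_remove: "free_below (B - {b}) b + card (B \<inter> {..<b}) = b"
proof -
  have "card ({..<b} - B) + card (B \<inter> {..<b}) = card {..<b}"
    using card_Diff_subset_Int[of "{..<b}" B] card_mono[of "{..<b}" "{..<b} \<inter> B"]
    by (simp add: Int_commute)
  moreover have "{..<b} - (B - {b}) = {..<b} - B" by auto
  ultimately show ?thesis by (simp add: free_below_def)
qed

text \<open>
  The key identity. Removing \<open>b\<close> from \<open>B\<close> takes away a factor \<open>\<alpha> ^ b\<close> in the weight \<open>\<alpha> ^ \<Sum>B\<close>. A throw
  to \<open>b\<close> brings in \<open>\<alpha>\<close> to the number of free sites below \<open>b\<close>, which is \<open>b\<close> minus the rank of \<open>b\<close>. The net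
  effect depends on \<open>b\<close> only through its rank, so summing over \<open>b\<close> gives a geometric sum that is the
  same for all sets \<open>B\<close> of the given size.
\<close>
lemma removal_weight:
  fixes \<alpha> :: real
  assumes "finite B" "b \<in> B" "\<alpha> \<noteq> 0"
  shows "\<alpha> ^ \<Sum>(B - {b}) * \<alpha> ^ free_below (B - {b}) b =
    \<alpha> ^ \<Sum>B * inverse \<alpha> ^ card (B \<inter> {..<b})"
proof -
  have "\<Sum>B = \<Sum>(B - {b}) + (free_below (B - {b}) b + card (B \<inter> {..<b}))"
    using assms free_below_remove[of B b] by (simp add: sum.remove)
  then show ?thesis using assms by (simp add: power_add power_inverse)
qed

section \<open>Singleton masses on a countable space\<close>

lemma prob_space_has_sum_singletons:
  assumes "prob_space \<pi>" and sets: "sets \<pi> = sets (count_space S)" and "countable S"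
  shows "((\<lambda>A. measure \<pi> {A}) has_sum 1) S"
proof -
  interpret prob_space \<pi> by fact
  have sp: "space \<pi> = S" using sets_eq_imp_space_eq[OF sets] by simp
  have "1 = emeasure \<pi> S" using emeasure_space_1 sp by simp
  also have "\<dots> = (\<integral>\<^sup>+A. emeasure \<pi> {A} \<partial>count_space S)"
    using sets \<open>countable S\<close> by (intro emeasure_countable_singleton) auto
  also have "\<dots> = (\<integral>\<^sup>+A. ennreal (measure \<pi> {A}) \<partial>count_space S)"
    by (simp add: emeasure_eq_measure)
  finally have nn: "(\<integral>\<^sup>+A. ennreal (measure \<pi> {A}) \<partial>count_space S) = 1" by (rule sym)
  then have int: "Infinite_Set_Sum.abs_summable_on (\<lambda>A. measure \<pi> {A}) S"
    unfolding abs_summable_on_def by (intro integrableI_nonneg) auto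
  then have "infsetsum (\<lambda>A. measure \<pi> {A}) S = 1"
    using nn_integral_conv_infsetsum[OF int] nn by simp
  moreover have "(\<lambda>A. measure \<pi> {A}) summable_on S"
    using abs_summable_equivalent[THEN iffD2, OF int] by simp
  ultimately show ?thesis
    using infsetsum_infsum[OF int] by (simp add: has_sum_iff)
qed

lemma countable_nsets_nat: "countable (nsets (UNIV :: nat set) n)"
  by (rule countable_subset[OF _ countable_Collect_finite]) (auto simp: nsets_def)

section \<open>Transitions of the juggler's exclusion process\<close>

lemma jep_matrix_shift: "jep_matrix \<nu> (Suc ` A) B = (if B = A then 1 else 0)"
  by (simp add: jep_matrix_def shift_down_def image_image)

lemma jep_matrix_throw_cases:
  assumes "finite C"
  shows "jep_matrix \<nu> (insert 0 (Suc ` C)) B =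
    (if \<exists>y. y \<notin> C \<and> B = insert y C then \<nu> C (THE y. y \<notin> C \<and> B = insert y C) else 0)"
proof -
  have "Min (insert 0 (Suc ` C)) = 0"
    using assms by (intro Min_eqI) auto
  moreover have "insert 0 (Suc ` C) - {0} = Suc ` C" by auto
  ultimately have "shift_down (drop_min (insert 0 (Suc ` C))) = C"
    by (simp add: drop_min_def shift_down_def image_image)
  then show ?thesis by (simp add: jep_matrix_def) blast
qed

lemma jep_matrix_throw:
  assumes "finite C" "y \<notin> C"
  shows "jep_matrix \<nu> (insert 0 (Suc ` C)) (insert y C) = \<nu> C y"
proof -
  have "(THE z. z \<notin> C \<and> insert y C = insert z C) = y"
    using assms by (intro the_equality) auto
  then show ?thesis using assms by (auto simp: jep_matrix_throw_cases)
qed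

lemma jep_matrix_throw_eq_0:
  assumes "finite C" "B \<notin> (\<lambda>y. insert y C) ` (- C)"
  shows "jep_matrix \<nu> (insert 0 (Suc ` C)) B = 0"
  using assms by (auto simp: jep_matrix_throw_cases)

text \<open>
  Writing states as images under \<^const>\<open>Suc\<close> removes the truncated subtraction from the
  transition matrix: the state \<open>Suc ` B\<close> moves to \<open>B\<close>, and \<open>insert 0 (Suc ` C)\<close> moves to \<open>C\<close> with one point
  added.
\<close>
lemma jep_state_cases:
  assumes "A \<in> nsets UNIV (Suc m)"
  obtains (shift) B where "B \<in> nsets UNIV (Suc m)" "A = Suc ` B"
    | (throw) C where "C \<in> nsets UNIV m" "A = insert 0 (Suc ` C)"
proof -
  define C where "C = Suc -` A"
  have "finite A" "card A = Suc m" using assms by (auto simp: nsets_def)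
  moreover from this have "finite C" unfolding C_def by (intro finite_vimageI) auto
  moreover have "card (Suc ` C) = card C" by (simp add: card_image)
  ultimately have fin: "finite C" "card (Suc ` C) = card C" "finite A" "card A = Suc m" by auto
  have A: "Suc ` C = A - {0}"
    by (auto simp: C_def image_iff gr0_conv_Suc)
  show thesis
  proof (cases "0 \<in> A")
    case True
    then have "A = insert 0 (Suc ` C)" "card C = m" using A fin by auto
    with fin show thesis by (intro throw[of C]) (auto simp: nsets_def)
  next
    case False
    then have "A = Suc ` C" "card C = Suc m" using A fin by auto
    with fin show thesis by (intro shift[of C]) (auto simp: nsets_def)
  qed
qed

lemma sum_shift_state:
  "finite C \<Longrightarrow> \<Sum>(Suc ` C) = \<Sum>C + card C"
  "finite C \<Longrightarrow> \<Sum>(insert 0 (Suc ` C)) = \<Sum>C + card C"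
  by (simp_all add: sum.reindex sum_Suc)

context
  fixes \<alpha> :: real
  assumes \<alpha>: "0 < \<alpha>" "\<alpha> < 1"
begin

lemma memoryless_pos: "y \<notin> B \<Longrightarrow> 0 < memoryless \<alpha> B y"
  using \<alpha> by (simp add: memoryless_def)

lemma jep_matrix_nonneg: "0 \<le> jep_matrix (memoryless \<alpha>) A B"
  using \<alpha> by (simp add: jep_matrix_def memoryless_def Let_def)

text \<open>
  The possible landing sites of a throw have distinct numbers of free sites below them, so a partial
  row sum is a subsum of \<open>\<Sum>k. (1 - \<alpha>) \<alpha> ^ k = 1\<close>.
\<close>
lemma jep_matrix_substochastic:
  assumes A: "A \<in> nsets UNIV (Suc m)" and F: "finite F"
  shows "(\<Sum>B\<in>F. jep_matrix (memoryless \<alpha>) A B) \<le> 1"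
  using A
proof (cases rule: jep_state_cases)
  case (shift B)
  then show ?thesis using F by (simp add: jep_matrix_shift)
next
  case (throw C)
  then have C: "finite C" by (simp add: nsets_def)
  define Y where "Y = {y. y \<notin> C \<and> insert y C \<in> F}"
  have inj: "inj_on (\<lambda>y. insert y C) Y" "inj_on (free_below C) Y"
    using free_below_inj[of C] by (auto simp: Y_def inj_on_def)
  have Y: "finite Y"
    by (rule finite_imageD[OF finite_subset[OF _ F] inj(1)]) (auto simp: Y_def)
  then obtain N where N: "free_below C ` Y \<subseteq> {..<N}"
    using finite_nat_iff_bounded[of "free_below C ` Y"] by auto
  have "(\<Sum>B\<in>F. jep_matrix (memoryless \<alpha>) A B) =
      (\<Sum>B\<in>(\<lambda>y. insert y C) ` Y. jep_matrix (memoryless \<alpha>) A B)"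
    using F C throw by (intro sum.mono_neutral_right) (auto simp: Y_def intro!: jep_matrix_throw_eq_0)
  also have "\<dots> = (\<Sum>y\<in>Y. (1 - \<alpha>) * \<alpha> ^ free_below C y)"
    using C throw inj
    by (simp add: sum.reindex jep_matrix_throw Y_def memoryless_def)
  also have "\<dots> = (\<Sum>k\<in>free_below C ` Y. (1 - \<alpha>) * \<alpha> ^ k)"
    using inj by (simp add: sum.reindex)
  also have "\<dots> \<le> (\<Sum>k<N. (1 - \<alpha>) * \<alpha> ^ k)"
    using N \<alpha> by (intro sum_mono2) auto
  also have "\<dots> = 1 - \<alpha> ^ N"
    by (simp add: one_diff_power_eq sum_distrib_left)
  also have "\<dots> \<le> 1" using \<alpha> by simp
  finally show ?thesis .
qed

text \<open>
  Always throw to the lowest free site. A shift lowers the sum of the positions. So does such a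
  throw, since the lowest free site \<open>y\<close> of an \<open>m\<close>-element set \<open>C\<close> satisfies \<open>y \<le> m\<close>, while the \<open>m\<close>
  shifted particles lower the sum by \<open>m\<close>. Only \<open>y = m\<close> gives no decrease, and then \<open>C\<close> is
  \<open>{..<m}\<close> and the current state is already the ground state.
\<close>
lemma jep_reaches_ground_state:
  assumes "A \<in> nsets UNIV (Suc m)"
  shows "(A, {..<Suc m}) \<in> {(A, B). A \<in> nsets UNIV (Suc m) \<and> B \<in> nsets UNIV (Suc m)
    \<and> 0 < jep_matrix (memoryless \<alpha>) A B}\<^sup>*" (is "_ \<in> ?R\<^sup>*")
  using assms
proof (induction "\<Sum>A" arbitrary: A rule: less_induct)
  case less
  from less.prems show ?case
  proof (cases rule: jep_state_cases)
    case (shift B)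
    then have "\<Sum>B < \<Sum>A" using sum_shift_state(1)[of B] by (auto simp: nsets_def)
    with less shift have "(B, {..<Suc m}) \<in> ?R\<^sup>*" by blast
    moreover have "(A, B) \<in> ?R" using shift less.prems by (simp add: jep_matrix_shift)
    ultimately show ?thesis by (rule converse_rtrancl_into_rtrancl[rotated])
  next
    case (throw C)
    then have C: "finite C" "card C = m" by (auto simp: nsets_def)
    define y where "y = (LEAST y. y \<notin> C)"
    have "\<exists>y. y \<notin> C" using ex_new_if_finite[OF infinite_UNIV_nat C(1)] .
    then have "y \<notin> C" unfolding y_def by (rule LeastI_ex)
    moreover have "{..<y} \<subseteq> C" using not_less_Least[of _ "\<lambda>y. y \<notin> C"] unfolding y_def by blast
    ultimately have y: "y \<notin> C" "{..<y} \<subseteq> C" .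
    have "y \<le> m" using card_mono[OF C(1) y(2)] C by simp
    show ?thesis
    proof (cases "y = m")
      case True
      then have "{..<m} = C" using y C by (intro card_subset_eq) auto
      then have "A = {..<Suc m}" using throw by (simp add: lessThan_Suc_eq_insert_0)
      then show ?thesis by simp
    next
      case False
      let ?B = "insert y C"
      have B: "?B \<in> nsets UNIV (Suc m)" using C y by (simp add: nsets_def)
      have "\<Sum>?B < \<Sum>A"
        using False \<open>y \<le> m\<close> C y sum_shift_state(2)[OF C(1)] throw by simp
      with less B have "(?B, {..<Suc m}) \<in> ?R\<^sup>*" by blast
      moreover have "(A, ?B) \<in> ?R"
        using throw less.prems B C y by (simp add: jep_matrix_throw memoryless_pos)
      ultimately show ?thesis by (rule converse_rtrancl_into_rtrancl[rotated])
    qed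
  qed
qed

lemma jep_equilibrium_unique:
  assumes "jep_equilibrium (Suc m) (memoryless \<alpha>) \<mu>" "jep_equilibrium (Suc m) (memoryless \<alpha>) \<pi>"
  shows "\<mu> = \<pi>"
proof (rule measure_eqI_countable)
  let ?S = "nsets (UNIV :: nat set) (Suc m)"
  have sets: "sets \<mu> = sets (count_space ?S)" "sets \<pi> = sets (count_space ?S)"
    and ps: "prob_space \<mu>" "prob_space \<pi>"
    and stat: "\<And>B. B \<in> ?S \<Longrightarrow>
        ((\<lambda>A. measure \<mu> {A} * jep_matrix (memoryless \<alpha>) A B) has_sum measure \<mu> {B}) ?S"
      "\<And>B. B \<in> ?S \<Longrightarrow>
        ((\<lambda>A. measure \<pi> {A} * jep_matrix (memoryless \<alpha>) A B) has_sum measure \<pi> {B}) ?S"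
    using assms by (auto simp: jep_equilibrium_def)
  interpret mu: prob_space \<mu> by fact
  interpret pi: prob_space \<pi> by fact
  show "sets \<mu> = Pow ?S" "sets \<pi> = Pow ?S" using sets by simp_all
  show "countable ?S" by (rule countable_nsets_nat)
  fix A assume A: "A \<in> ?S"
  have "measure \<mu> {A} = measure \<pi> {A}"
    by (rule stationary_unique[where P = "jep_matrix (memoryless \<alpha>)" and S = ?S and s = "{..<Suc m}" and t = 1,
          OF jep_matrix_nonneg jep_matrix_substochastic jep_reaches_ground_state
            prob_space_has_sum_singletons[OF ps(1) sets(1) countable_nsets_nat]
            prob_space_has_sum_singletons[OF ps(2) sets(2) countable_nsets_nat] stat A])
  then show "emeasure \<mu> {A} = emeasure \<pi> {A}"
    by (simp add: mu.emeasure_eq_measure pi.emeasure_eq_measure)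
qed

section \<open>Stationarity of the geometric weight\<close>

text \<open>
  The states that can move to \<open>B\<close> are \<open>Suc ` B\<close>, by a shift, and for every \<open>b\<close> in \<open>B\<close> the state
  \<open>insert 0 (Suc ` (B - {b}))\<close>, by a throw to \<open>b\<close>. The shift contributes \<open>\<alpha> ^ Suc m\<close> relative to the
  weight of \<open>B\<close>. By \<open>removal_weight\<close> a throw to a point of rank \<open>i\<close> contributes \<open>(1 - \<alpha>) \<alpha> ^ (m - i)\<close>, and
  these add up to \<open>1 - \<alpha> ^ Suc m\<close>.
\<close>
lemma geometric_weight_stationary:
  assumes B: "B \<in> nsets UNIV (Suc m)"
  shows "((\<lambda>A. c * \<alpha> ^ \<Sum>A * jep_matrix (memoryless \<alpha>) A B) has_sum c * \<alpha> ^ \<Sum>B)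
    (nsets UNIV (Suc m))"
proof (rule has_sum_finite_neutralI)
  let ?P = "jep_matrix (memoryless \<alpha>)"
  let ?pre = "\<lambda>b. insert 0 (Suc ` (B - {b}))"
  let ?T = "insert (Suc ` B) (?pre ` B)"
  have fin: "finite B" "card B = Suc m" using B by (auto simp: nsets_def)
  have card: "card (B - {b}) = m" if "b \<in> B" for b using fin that by simp
  show "finite ?T" using fin by simp
  show "?T \<subseteq> nsets UNIV (Suc m)"
    using fin by (auto simp: nsets_def card_image)
  show "c * \<alpha> ^ \<Sum>A * ?P A B = 0" if "A \<in> nsets UNIV (Suc m) - ?T" for A
  proof -
    from that have "A \<in> nsets UNIV (Suc m)" by simp
    then have "?P A B = 0"
    proof (cases rule: jep_state_cases)
      case (shift B')
      with that show ?thesis by (auto simp: jep_matrix_shift)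
    next
      case (throw C)
      have "B \<notin> (\<lambda>y. insert y C) ` (- C)"
      proof
        assume "B \<in> (\<lambda>y. insert y C) ` (- C)"
        then obtain y where "y \<notin> C" "B = insert y C" by auto
        then have "y \<in> B" "B - {y} = C" by auto
        with that throw show False by blast
      qed
      with throw show ?thesis by (simp add: jep_matrix_throw_eq_0 nsets_def)
    qed
    then show ?thesis by simp
  qed
  have throw: "c * \<alpha> ^ \<Sum>(?pre b) * ?P (?pre b) B =
      c * \<alpha> ^ \<Sum>B * ((1 - \<alpha>) * (\<alpha> ^ m * inverse \<alpha> ^ card (B \<inter> {..<b})))" if "b \<in> B" for b
  proof -
    have "?P (?pre b) (insert b (B - {b})) = (1 - \<alpha>) * \<alpha> ^ free_below (B - {b}) b"
      using fin by (subst jep_matrix_throw) (auto simp: memoryless_def)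
    moreover have "insert b (B - {b}) = B" using that by auto
    moreover have "\<Sum>(?pre b) = \<Sum>(B - {b}) + m"
      using sum_shift_state(2)[of "B - {b}"] fin card[OF that] by simp
    ultimately show ?thesis
      using removal_weight[OF fin(1) that, of \<alpha>] \<alpha> by (simp add: power_add mult_ac)
  qed
  have inj: "inj_on ?pre B"
  proof (rule inj_onI)
    fix x y assume xy: "x \<in> B" "y \<in> B" "?pre x = ?pre y"
    have "Suc ` (B - {x}) = ?pre x - {0}" "Suc ` (B - {y}) = ?pre y - {0}" by auto
    then have "B - {x} = B - {y}" using xy(3) by (simp add: inj_image_eq_iff)
    then show "x = y" using xy by blast
  qed
  have geo: "(\<Sum>i<Suc m. \<alpha> ^ m * inverse \<alpha> ^ i) = (\<Sum>i<Suc m. \<alpha> ^ i)"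
  proof -
    have "(\<Sum>i<Suc m. \<alpha> ^ m * inverse \<alpha> ^ i) = (\<Sum>i<Suc m. \<alpha> ^ (Suc m - Suc i))"
      using \<alpha> by (intro sum.cong) (auto simp: power_diff power_inverse divide_inverse)
    then show ?thesis by (simp only: sum.nat_diff_reindex)
  qed
  have "(\<Sum>A\<in>?T. c * \<alpha> ^ \<Sum>A * ?P A B) =
      c * \<alpha> ^ \<Sum>(Suc ` B) * ?P (Suc ` B) B + (\<Sum>b\<in>B. c * \<alpha> ^ \<Sum>(?pre b) * ?P (?pre b) B)"
    using fin inj by (subst sum.insert) (auto simp: sum.reindex)
  also have "\<dots> = c * \<alpha> ^ \<Sum>B * \<alpha> ^ Suc m + c * \<alpha> ^ \<Sum>B * ((1 - \<alpha>) *
      (\<Sum>b\<in>B. \<alpha> ^ m * inverse \<alpha> ^ card (B \<inter> {..<b})))"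
    unfolding sum_distrib_left
    using sum_shift_state(1)[OF fin(1)] fin
    by (intro arg_cong2[where f = "(+)"] sum.cong throw refl)
      (simp add: jep_matrix_shift power_add)
  also have "\<dots> = c * \<alpha> ^ \<Sum>B * (\<alpha> ^ Suc m + (1 - \<alpha>) * (\<Sum>i<Suc m. \<alpha> ^ i))"
    using sum_over_ranks[OF fin(1), of "\<lambda>i. \<alpha> ^ m * inverse \<alpha> ^ i"] fin geo
    by (simp only: distrib_left)
  also have "\<dots> = c * \<alpha> ^ \<Sum>B"
    by (simp only: one_diff_power_eq[symmetric]) simp
  finally show "c * \<alpha> ^ \<Sum>B = (\<Sum>A\<in>?T. c * \<alpha> ^ \<Sum>A * ?P A B)" by simp
qed

section \<open>The law of the noncolliding union\<close>

text \<open>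
  Conditioning on the point \<open>b\<close> of \<open>B\<close> that was added last gives
  \<open>P(G\<^sub>k\<^sub>+\<^sub>1 = B) = (\<Sum>b\<in>B. P(G\<^sub>k = B - {b}) P(\<xi>\<^sub>k\<^sub>+\<^sub>1 = free_below (B - {b}) b))\<close>, because \<open>G\<^sub>k\<close> is a function of
  \<open>\<xi>\<^sub>1, \<dots>, \<xi>\<^sub>k\<close>. By \<open>removal_weight\<close> the law of \<open>G\<^sub>k\<close> therefore keeps the form of a constant times
  \<open>\<alpha> ^ \<Sum>B\<close>.
\<close>
lemma
  fixes M :: "'w measure" and \<xi> :: "nat \<Rightarrow> 'w \<Rightarrow> nat"
  assumes "prob_space M"
    and indep: "prob_space.indep_vars M (\<lambda>_. count_space UNIV) \<xi> {1..n}"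
    and geo: "\<forall>i\<in>{1..n}. \<forall>k. measure M {\<omega> \<in> space M. \<xi> i \<omega> = k} = (1 - \<alpha>) * \<alpha> ^ k"
    and "k \<le> n"
  shows measurable_noncolliding_union:
      "(\<lambda>\<omega>. noncolliding_union {} (\<lambda>i. \<xi> i \<omega>) k) \<in> measurable M (count_space (nsets UNIV k))" (is ?A)
    and prob_noncolliding_union: "B \<in> nsets UNIV k \<Longrightarrow>
      measure M {\<omega> \<in> space M. noncolliding_union {} (\<lambda>i. \<xi> i \<omega>) k = B} =
      (\<Prod>j<k. (1 - \<alpha>) * (\<Sum>i\<le>j. inverse \<alpha> ^ i)) * \<alpha> ^ \<Sum>B" (is "_ \<Longrightarrow> ?B")
proof -
  interpret prob_space M by fact
  let ?G = "\<lambda>k \<omega>. noncolliding_union {} (\<lambda>i. \<xi> i \<omega>) k"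
  have G_eq: "(\<lambda>x. noncolliding_union {} x k) \<circ> (\<lambda>\<omega>. restrict (\<lambda>i. \<xi> i \<omega>) {1..k}) = ?G k" for k
    unfolding comp_def by (intro ext noncolliding_union_cong) simp
  have G_meas: "(\<lambda>x. noncolliding_union {} x k) \<in>
      measurable (PiM {1..k} (\<lambda>_. count_space UNIV)) (count_space (nsets UNIV k))" for k
    using noncolliding_union_nsets by (subst count_space_PiM_finite) auto
  have \<xi>: "\<xi> i \<in> measurable M (count_space UNIV)" if "i \<in> {1..n}" for i
    using indep that by (auto simp: indep_vars_def)
  have meas: "?G k \<in> measurable M (count_space (nsets UNIV k))" if "k \<le> n" for k
    unfolding G_eq[symmetric]
    by (rule measurable_comp[OF measurable_restrict G_meas]) (use that \<xi> in auto)
  show ?A using \<open>k \<le> n\<close> by (rule meas)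
  have "\<forall>B\<in>nsets UNIV k. prob {\<omega> \<in> space M. ?G k \<omega> = B} =
      (\<Prod>j<k. (1 - \<alpha>) * (\<Sum>i\<le>j. inverse \<alpha> ^ i)) * \<alpha> ^ \<Sum>B"
    using \<open>k \<le> n\<close>
  proof (induction k)
    case 0
    then show ?case by (auto simp: nsets_def prob_space)
  next
    case (Suc k)
    show ?case
    proof
      fix B :: "nat set" assume B: "B \<in> nsets UNIV (Suc k)"
      then have fin: "finite B" "card B = Suc k" by (auto simp: nsets_def)
      let ?E = "\<lambda>b. {\<omega> \<in> space M. ?G k \<omega> = B - {b} \<and> \<xi> (Suc k) \<omega> = free_below (B - {b}) b}"
      let ?c = "\<Prod>j<k. (1 - \<alpha>) * (\<Sum>i\<le>j. inverse \<alpha> ^ i)"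
      have Bk: "B - {b} \<in> nsets UNIV k" if "b \<in> B" for b
        using fin that by (simp add: nsets_def)
      let ?R = "\<lambda>J \<omega>. restrict (\<lambda>i. \<xi> i \<omega>) J"
      have ind: "indep_var (PiM {1..k} (\<lambda>_. count_space UNIV)) (?R {1..k})
          (PiM {Suc k} (\<lambda>_. count_space UNIV)) (?R {Suc k})"
        using Suc.prems by (intro indep_var_restrict[OF indep]) auto
      have E: "prob (?E b) = ?c * (1 - \<alpha>) * (\<alpha> ^ \<Sum>B * inverse \<alpha> ^ card (B \<inter> {..<b}))"
        if b: "b \<in> B" for b
      proof -
        let ?X = "{x \<in> PiE {1..k} (\<lambda>_. UNIV). noncolliding_union {} x k = B - {b}}"
        let ?Y = "{x \<in> PiE {Suc k} (\<lambda>_. UNIV). x (Suc k) = free_below (B - {b}) b}"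
        have G_R: "noncolliding_union {} (?R {1..k} \<omega>) k = ?G k \<omega>" for \<omega>
          using fun_cong[OF G_eq[of k], of \<omega>] by simp
        have "prob ((\<lambda>\<omega>. (?R {1..k} \<omega>, ?R {Suc k} \<omega>)) -` (?X \<times> ?Y) \<inter> space M) =
          prob (?R {1..k} -` ?X \<inter> space M) * prob (?R {Suc k} -` ?Y \<inter> space M)"
          by (rule indep_varD[OF ind]) (simp_all add: count_space_PiM_finite)
        also have "?R {1..k} -` ?X \<inter> space M = {\<omega> \<in> space M. ?G k \<omega> = B - {b}}"
          using G_R by auto
        also have "?R {Suc k} -` ?Y \<inter> space M =
            {\<omega> \<in> space M. \<xi> (Suc k) \<omega> = free_below (B - {b}) b}" by auto
        also have "(\<lambda>\<omega>. (?R {1..k} \<omega>, ?R {Suc k} \<omega>)) -` (?X \<times> ?Y) \<inter> space M = ?E b"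
          using G_R by auto
        finally show ?thesis
          using Suc.IH Suc.prems Bk[OF b] geo removal_weight[OF fin(1) b, of \<alpha>] \<alpha>
          by (simp add: mult_ac)
      qed
      have E_sets: "?E b \<in> events" if "b \<in> B" for b
      proof -
        have "?G k -` {B - {b}} \<inter> space M \<in> events"
          using meas[of k] Suc.prems Bk[OF that] by (intro measurable_sets) auto
        moreover have "\<xi> (Suc k) -` {free_below (B - {b}) b} \<inter> space M \<in> events"
          using \<xi>[of "Suc k"] Suc.prems by (intro measurable_sets) auto
        moreover have "?E b = (?G k -` {B - {b}} \<inter> space M) \<inter>
            (\<xi> (Suc k) -` {free_below (B - {b}) b} \<inter> space M)" by auto
        ultimately show ?thesis by simp
      qed
      have "{\<omega> \<in> space M. ?G (Suc k) \<omega> = B} = (\<Union>b\<in>B. ?E b)"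
        using noncolliding_union_Suc_eq_iff[OF B] by blast
      also have "prob \<dots> = (\<Sum>b\<in>B. prob (?E b))"
      proof (rule finite_measure_finite_Union[OF fin(1)])
        show "disjoint_family_on ?E B"
        unfolding disjoint_family_on_def
        proof (intro ballI impI)
          fix x y assume "x \<in> B" "y \<in> B" "x \<noteq> y"
          then have "B - {x} \<noteq> B - {y}" by blast
          then show "?E x \<inter> ?E y = {}" by auto
        qed
      qed (use E_sets in auto)
      also have "\<dots> = (\<Sum>b\<in>B. ?c * (1 - \<alpha>) * (\<alpha> ^ \<Sum>B * inverse \<alpha> ^ card (B \<inter> {..<b})))"
        using E by (intro sum.cong) auto
      also have "\<dots> = ?c * (1 - \<alpha>) * (\<alpha> ^ \<Sum>B * (\<Sum>i<Suc k. inverse \<alpha> ^ i))"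
        using sum_over_ranks[OF fin(1), of "\<lambda>i. inverse \<alpha> ^ i"] fin
        by (simp only: sum_distrib_left[symmetric])
      also have "\<dots> = ?c * ((1 - \<alpha>) * (\<Sum>i\<le>k. inverse \<alpha> ^ i)) * \<alpha> ^ \<Sum>B"
        by (simp add: lessThan_Suc_atMost mult_ac)
      finally show "prob {\<omega> \<in> space M. ?G (Suc k) \<omega> = B} =
          (\<Prod>j<Suc k. (1 - \<alpha>) * (\<Sum>i\<le>j. inverse \<alpha> ^ i)) * \<alpha> ^ \<Sum>B"
        by (simp only: prod.lessThan_Suc)
    qed
  qed
  then show ?B if "B \<in> nsets UNIV k" using that by blast
qed

lemma jep_equilibrium_noncolliding_union:
  fixes M :: "'w measure" and \<xi> :: "nat \<Rightarrow> 'w \<Rightarrow> nat"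
  assumes "prob_space M"
    and indep: "prob_space.indep_vars M (\<lambda>_. count_space UNIV) \<xi> {1..Suc m}"
    and geo: "\<forall>i\<in>{1..Suc m}. \<forall>k. measure M {\<omega> \<in> space M. \<xi> i \<omega> = k} = (1 - \<alpha>) * \<alpha> ^ k"
  shows "jep_equilibrium (Suc m) (memoryless \<alpha>)
    (distr M (count_space (nsets UNIV (Suc m))) (\<lambda>\<omega>. noncolliding_union {} (\<lambda>i. \<xi> i \<omega>) (Suc m)))"
proof -
  interpret prob_space M by fact
  let ?S = "nsets (UNIV :: nat set) (Suc m)"
  let ?G = "\<lambda>\<omega>. noncolliding_union {} (\<lambda>i. \<xi> i \<omega>) (Suc m)"
  let ?\<pi> = "distr M (count_space ?S) ?G"
  define c where "c = (\<Prod>j<Suc m. (1 - \<alpha>) * (\<Sum>i\<le>j. inverse \<alpha> ^ i))"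
  note G = measurable_noncolliding_union[OF assms order_refl]
  have law: "measure ?\<pi> {B} = c * \<alpha> ^ \<Sum>B" if "B \<in> ?S" for B
  proof -
    have "measure ?\<pi> {B} = prob {\<omega> \<in> space M. ?G \<omega> = B}"
      using that by (subst measure_distr[OF G]) (auto intro!: arg_cong[where f = prob])
    then show ?thesis
      using prob_noncolliding_union[OF assms order_refl that] by (simp only: c_def)
  qed
  show ?thesis
    unfolding jep_equilibrium_def
  proof (intro conjI ballI)
    show "prob_space ?\<pi>" using G by (rule prob_space_distr)
    show "((\<lambda>A. measure ?\<pi> {A} * jep_matrix (memoryless \<alpha>) A B) has_sum measure ?\<pi> {B}) ?S"
      if "B \<in> ?S" for B
    proof -
      have "((\<lambda>A. measure ?\<pi> {A} * jep_matrix (memoryless \<alpha>) A B) has_sum c * \<alpha> ^ \<Sum>B) ?S \<longleftrightarrow>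
          ((\<lambda>A. c * \<alpha> ^ \<Sum>A * jep_matrix (memoryless \<alpha>) A B) has_sum c * \<alpha> ^ \<Sum>B) ?S"
        by (rule has_sum_cong) (simp only: law)
      then show ?thesis
        using geometric_weight_stationary[OF that, of c] by (simp only: law[OF that])
    qed
  qed (rule sets_distr)
qed

text \<open>
  The coordinates of a product of geometric distributions are suitable variables \<open>\<xi>\<^sub>i\<close>. Taking the law of
  their noncolliding union as the witness shows at once that the weight \<open>\<alpha> ^ \<Sum>B\<close> has finite total
  mass and is correctly normalised.
\<close>
lemma jep_equilibrium_exists: "\<exists>\<pi>. jep_equilibrium (Suc m) (memoryless \<alpha>) \<pi>"
proof -
  define p where "p = Pi_pmf {1..Suc m} 0 (\<lambda>_. geometric_pmf (1 - \<alpha>))"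
  have "measure p {\<omega> \<in> space p. \<omega> i = k} = (1 - \<alpha>) * \<alpha> ^ k" if i: "i \<in> {1..Suc m}" for i k
  proof -
    have "measure p {\<omega> \<in> space p. \<omega> i = k} = pmf (map_pmf (\<lambda>\<omega>. \<omega> i) p) k"
      by (auto simp: pmf_map vimage_def)
    also have "map_pmf (\<lambda>\<omega>. \<omega> i) p = geometric_pmf (1 - \<alpha>)"
      unfolding p_def using i by (subst Pi_pmf_component) auto
    finally show ?thesis using \<alpha> by (simp add: geometric_pmf.rep_eq)
  qed
  moreover have "prob_space.indep_vars p (\<lambda>_. count_space UNIV) (\<lambda>i \<omega>. \<omega> i) {1..Suc m}"
    unfolding p_def by (rule indep_vars_Pi_pmf) simp
  ultimately show ?thesis
    using jep_equilibrium_noncolliding_union[OF measure_pmf.prob_space_axioms] by blast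
qed

end

section \<open>Unique equilibrium\<close>

theorem theorem3p6:
  fixes n :: nat and \<alpha> :: real
  assumes "n \<ge> 1" and "0 < \<alpha>" and "\<alpha> < 1"
  shows "(\<exists>!\<pi>. jep_equilibrium n (memoryless \<alpha>) \<pi>) \<and>
    (\<forall>(M :: 'w measure) (\<xi> :: nat \<Rightarrow> 'w \<Rightarrow> nat).
      prob_space M \<longrightarrow>
      prob_space.indep_vars M (\<lambda>_. count_space UNIV) \<xi> {1..n} \<longrightarrow>
      (\<forall>i\<in>{1..n}. \<forall>k. measure M {\<omega> \<in> space M. \<xi> i \<omega> = k} = (1 - \<alpha>) * \<alpha> ^ k) \<longrightarrow>
      jep_equilibrium n (memoryless \<alpha>)
        (distr M (count_space (nsets UNIV n))
          (\<lambda>\<omega>. noncolliding_union {} (\<lambda>i. \<xi> i \<omega>) n)))"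
proof -
  obtain m where n: "n = Suc m" using \<open>n \<ge> 1\<close> by (cases n) auto
  show ?thesis
    unfolding n
  proof (intro conjI allI impI)
    show "\<exists>!\<pi>. jep_equilibrium (Suc m) (memoryless \<alpha>) \<pi>"
      using jep_equilibrium_exists[OF assms(2,3)] jep_equilibrium_unique[OF assms(2,3)] by blast
  qed (rule jep_equilibrium_noncolliding_union[OF assms(2,3)])
qed

end
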